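(* Let $F$ be a plane forest with $n$ vertices and let $w$ be a signed labeling of $F$ on $\{1,2,\ldots,n\}$. Then, as formal power series in $x$, \[ \frac{\sum_{\sigma\in\mathcal{L}(F,w)}x^{\mathrm{des}_B(\sigma)}}{(1-x)^{n+1}}=\sum_{t\ge0}\Omega_F(w,t)\,x^t. \]
   Context: A plane forest $F$ is partially ordered by $x<_F y$ iff $y$ is a proper ancestor of $x$. In particular, the roots are the maximal elements. A signed labeling of $F$ on $\{1,\ldots,n\}$ assigns to each vertex $x$ a label $w(x)\in\{\pm1,\ldots,\pm n\}$ so that $x\mapsto|w(x)|$ is a bijection onto $\{1,\ldots,n\}$. A linear extension of $F$ is an ordering $x_1\cdots x_n$ of its vertices such that $x_j<_F x_k$ implies $j<k$. $\mathcal{L}(F,w)$ is the set of words $w(x_1)\cdots w(x_n)$ over the linear extensions $x_1\cdots x_n$ of $F$. For a word $\sigma=\sigma_1\cdots\sigma_n$ of nonzero integers, define $\mathrm{Des}_B(\sigma)=\{i:1\le i\le n-1,\ \sigma_i>\sigma_{i+1}\}\cup\{n\text{ if }\sigma_n>0\}$ and $\mathrm{des}_B(\sigma)=|\mathrm{Des}_B(\sigma)|$. A type $B$ $(F,w)$-partition is a map $f$ from the vertices of $F$ to $\mathbb{N}=\{0,1,2,\ldots\}$ satisfying three conditions: (1) $f(x)\le f(y)$ whenever $x\ge_F y$; (2) $f(x)<f(y)$ whenever $x>_F y$ and $w(x)<w(y)$; (3) $f(x)\ge1$ whenever $x$ is a root with $w(x)>0$. For $t\in\mathbb{N}$, $\Omega_F(w,t)$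 denotes the number of type $B$ $(F,w)$-partitions $f$ with $f(x)\le t$ for all vertices $x$. *)

theory Defs
  imports
    "HOL-Library.Sublist"
    "HOL-Library.FuncSet"
    "HOL-Computational_Algebra.Formal_Power_Series"
begin

datatype plane_tree = Node (children: "plane_tree list")

type_synonym plane_forest = "plane_tree list"

text \<open>
  A vertex is encoded by its address: the nonempty list \<open>[i\<^sub>0, \<dots>, i\<^sub>k]\<close> is the vertex reached from
  the root of the \<open>i\<^sub>0\<close>-th tree by descending to the \<open>i\<^sub>1\<close>-th child, and so on (counting from 0).
  Hence the proper ancestors of a vertex are its proper nonempty prefixes.
\<close>

type_synonym vertex = "nat list"

inductive is_vertex :: "plane_forest \<Rightarrow> vertex \<Rightarrow> bool" where
  root: "i < length F \<Longrightarrow> is_vertex F [i]"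
| below: "i < length F \<Longrightarrow> is_vertex (children (F ! i)) p \<Longrightarrow> is_vertex F (i # p)"

definition vertices :: "plane_forest \<Rightarrow> vertex set" where
  "vertices F = {p. is_vertex F p}"

definition roots :: "plane_forest \<Rightarrow> vertex set" where
  "roots F = {[i] | i. i < length F}"

definition forest_less :: "plane_forest \<Rightarrow> vertex \<Rightarrow> vertex \<Rightarrow> bool" where
  "forest_less F x y \<longleftrightarrow> x \<in> vertices F \<and> y \<in> vertices F \<and> strict_prefix y x"

definition forest_le :: "plane_forest \<Rightarrow> vertex \<Rightarrow> vertex \<Rightarrow> bool" where
  "forest_le F x y \<longleftrightarrow> x \<in> vertices F \<and> y \<in> vertices F \<and> (x = y \<or> forest_less F x y)"

definition signed_labeling :: "plane_forest \<Rightarrow> nat \<Rightarrow> (vertex \<Rightarrow> int) \<Rightarrow> bool" where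
  "signed_labeling F n w \<longleftrightarrow>
     (\<forall>x \<in> vertices F. w x \<in> {- int n..int n} - {0}) \<and>
     bij_betw (\<lambda>x. \<bar>w x\<bar>) (vertices F) {1..int n}"

definition linear_extensions :: "plane_forest \<Rightarrow> vertex list set" where
  "linear_extensions F =
     {xs. distinct xs \<and> set xs = vertices F \<and>
          (\<forall>j < length xs. \<forall>k < length xs. forest_less F (xs ! j) (xs ! k) \<longrightarrow> j < k)}"

definition linear_extension_words :: "plane_forest \<Rightarrow> (vertex \<Rightarrow> int) \<Rightarrow> int list set" where
  "linear_extension_words F w = map w ` linear_extensions F"

text \<open>Descent positions are counted from 1, whereas \<open>!\<close> counts from 0.\<close>

definition Des_B :: "int list \<Rightarrow> nat set" where
  "Des_B \<sigma> =
     {i. 1 \<le> i \<and> i < length \<sigma> \<and> \<sigma> ! (i - 1) > \<sigma> ! i} \<union>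
     {i. i = length \<sigma> \<and> \<sigma> \<noteq> [] \<and> last \<sigma> > 0}"

definition des_B :: "int list \<Rightarrow> nat" where
  "des_B \<sigma> = card (Des_B \<sigma>)"

text \<open>
  Maps on the vertices are taken to be extensional, so that each of them is counted exactly once.
\<close>

definition type_B_partitions :: "plane_forest \<Rightarrow> (vertex \<Rightarrow> int) \<Rightarrow> (vertex \<Rightarrow> nat) set" where
  "type_B_partitions F w =
     {f \<in> vertices F \<rightarrow>\<^sub>E UNIV.
        (\<forall>x y. forest_le F y x \<longrightarrow> f x \<le> f y) \<and>
        (\<forall>x y. forest_less F y x \<and> w x < w y \<longrightarrow> f x < f y) \<and>
        (\<forall>x \<in> roots F. w x > 0 \<longrightarrow> f x \<ge> 1)}"

definition Omega :: "plane_forest \<Rightarrow> (vertex \<Rightarrow> int) \<Rightarrow> nat \<Rightarrow> nat" where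
  "Omega F w t = card {f \<in> type_B_partitions F w. \<forall>x \<in> vertices F. f x \<le> t}"

lemma vertices_unfold:
  "vertices F = (\<Union>i < length F. insert [i] ((#) i ` vertices (children (F ! i))))"
proof (rule set_eqI)
  fix p
  show "p \<in> vertices F \<longleftrightarrow>
        p \<in> (\<Union>i < length F. insert [i] ((#) i ` vertices (children (F ! i))))"
    unfolding vertices_def mem_Collect_eq by (subst is_vertex.simps) auto
qed

lemma finite_vertices: "finite (vertices F)"
proof (induction "size_list size F" arbitrary: F rule: less_induct)
  case less
  have "finite (vertices (children (F ! i)))" if "i < length F" for i
  proof (rule less)
    have "size_list size (children (F ! i)) < size (F ! i)"
      by (cases "F ! i") simp
    also have "\<dots> \<le> size_list size F"
      using that by (intro size_list_estimation'[of "F ! i"]) auto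
    finally show "size_list size (children (F ! i)) < size_list size F" .
  qed
  then show ?case
    by (subst vertices_unfold) auto
qed

lemma roots_eq_maximal: "roots F = {x \<in> vertices F. \<not> (\<exists>y. forest_less F x y)}"
proof (rule set_eqI)
  fix x
  have nonempty: "p \<noteq> []" if "is_vertex F p" for p
    using that by cases auto
  have iff: "x \<in> roots F \<longleftrightarrow> (\<exists>i. x = [i] \<and> i < length F)"
    by (auto simp: roots_def)
  show "x \<in> roots F \<longleftrightarrow> x \<in> {x \<in> vertices F. \<not> (\<exists>y. forest_less F x y)}"
  proof
    assume "x \<in> roots F"
    then obtain i where i: "x = [i]" "i < length F"
      using iff by blast
    have "\<not> forest_less F x y" for y
    proof
      assume "forest_less F x y"
      then have "is_vertex F y" and "strict_prefix y x"
        by (auto simp: forest_less_def vertices_def)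
      then show False
        using nonempty[of y] i by (cases y) (auto simp: strict_prefix_def)
    qed
    then show "x \<in> {x \<in> vertices F. \<not> (\<exists>y. forest_less F x y)}"
      using i by (auto simp: vertices_def intro: is_vertex.root)
  next
    assume "x \<in> {x \<in> vertices F. \<not> (\<exists>y. forest_less F x y)}"
    then have x: "is_vertex F x" and max: "\<not> forest_less F x y" for y
      by (auto simp: vertices_def)
    from x obtain i p where ip: "x = i # p" "i < length F"
      by cases auto
    have "is_vertex F [i]"
      using ip(2) by (rule is_vertex.root)
    then have "\<not> strict_prefix [i] x"
      using max[of "[i]"] x by (simp add: forest_less_def vertices_def)
    then have "p = []"
      using ip(1) by (auto simp: strict_prefix_def)
    then show "x \<in> roots F"
      using iff ip by blast
  qed
qed

end

theory Submission
  imports Defs "HOL-Library.Product_Lexorder"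
begin

text \<open>
  Order the vertices by the key \<open>(- f x, w x)\<close>, compared lexicographically. A map \<open>f\<close> is a type B
  partition iff its key is monotone along the forest and bounded by \<open>(0, 0)\<close>, which acts as the key
  of an extra vertex on top of all the roots. As \<open>w\<close> is injective, exactly one ordering of the
  vertices sorts the keys of \<open>f\<close>, and the keys are monotone along the forest iff that ordering is a
  linear extension. It remains to count, for a fixed linear extension \<open>x\<^sub>1 \<dots> x\<^sub>n\<close> with label word
  \<open>\<sigma>\<close>, the maps with \<open>t \<ge> f x\<^sub>1 \<ge> \<dots> \<ge> f x\<^sub>n \<ge> 0\<close> that decrease strictly at the type B descents
  of \<open>\<sigma>\<close>, i.e. at the ordinary descents of \<open>\<sigma> @ [0]\<close>. Adding a letter in front of \<open>\<sigma>\<close> divides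
  their generating function by \<open>1 - x\<close>, and multiplies it by \<open>x\<close> if the letter creates a descent.
\<close>

subsection \<open>Type B descents\<close>

lemma Des_B_Cons:
  "Des_B (s # \<sigma>) = (if hd (\<sigma> @ [0]) < s then {1} else {}) \<union> Suc ` Des_B \<sigma>"
proof (rule set_eqI)
  fix i
  show "i \<in> Des_B (s # \<sigma>) \<longleftrightarrow> i \<in> (if hd (\<sigma> @ [0]) < s then {1} else {}) \<union> Suc ` Des_B \<sigma>"
  proof (cases i)
    case 0
    then show ?thesis by (auto simp: Des_B_def)
  next
    case (Suc j)
    then show ?thesis
      by (cases \<sigma>; cases j) (auto simp: Des_B_def image_iff)
  qed
qed

lemma des_B_Nil: "des_B [] = 0"
  by (simp add: des_B_def Des_B_def)

lemma des_B_Cons: "des_B (s # \<sigma>) = of_bool (hd (\<sigma> @ [0]) < s) + des_B \<sigma>"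
proof -
  have "finite (Des_B \<sigma>)"
    by (rule finite_subset[of _ "{..length \<sigma>}"]) (auto simp: Des_B_def)
  moreover have "1 \<notin> Suc ` Des_B \<sigma>"
    by (auto simp: Des_B_def)
  ultimately show ?thesis
    by (simp add: des_B_def Des_B_Cons card_image)
qed

subsection \<open>Maps compatible with a list\<close>

definition lex_key :: "('a \<Rightarrow> 'b) \<Rightarrow> ('a \<Rightarrow> nat) \<Rightarrow> 'a \<Rightarrow> int \<times> 'b" where
  "lex_key w f x = (- int (f x), w x)"

lemma lex_key_le_iff:
  fixes w :: "'a \<Rightarrow> 'b::linorder"
  shows "lex_key w f y \<le> lex_key w f x \<longleftrightarrow> f x \<le> f y \<and> (w x < w y \<longrightarrow> f x < f y)"
  by (auto simp: lex_key_def)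

lemma lex_key_le_zero_iff:
  fixes w :: "'a \<Rightarrow> 'b::{linorder,zero}"
  shows "lex_key w f x \<le> (0, 0) \<longleftrightarrow> (0 < w x \<longrightarrow> 1 \<le> f x)"
  by (auto simp: lex_key_def)

lemma inj_on_lex_key: "inj_on w A \<Longrightarrow> inj_on (lex_key w f) A"
  by (auto simp: inj_on_def lex_key_def)

definition compatible_maps ::
  "('a \<Rightarrow> 'b::{linorder,zero}) \<Rightarrow> 'a list \<Rightarrow> nat \<Rightarrow> ('a \<Rightarrow> nat) set" where
  "compatible_maps w xs t =
     {f \<in> set xs \<rightarrow>\<^sub>E {..t}. sorted (map (lex_key w f) xs @ [(0, 0)])}"

lemma finite_compatible_maps: "finite (compatible_maps w xs t)"
  by (rule finite_subset[of _ "set xs \<rightarrow>\<^sub>E {..t}"])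
    (auto simp: compatible_maps_def intro: finite_PiE)

lemma compatible_maps_Nil: "compatible_maps w [] t = {\<lambda>_. undefined}"
  by (auto simp: compatible_maps_def)

lemma sorted_lex_keys_Cons_iff:
  fixes w :: "'a \<Rightarrow> 'b::{linorder,zero}" and x :: 'a and xs :: "'a list"
  defines "d \<equiv> of_bool (hd (map w xs @ [0]) < w x) :: nat"
  shows "sorted (map (lex_key w f) (x # xs) @ [(0, 0)]) \<longleftrightarrow>
    d \<le> f x \<and> (\<forall>y \<in> set xs. f y \<le> f x - d) \<and> sorted (map (lex_key w f) xs @ [(0, 0)])"
proof (cases xs)
  case Nil
  then show ?thesis
    by (auto simp: d_def lex_key_le_zero_iff)
next
  case (Cons y ys)
  have "sorted (map (lex_key w f) (x # xs) @ [(0, 0)]) \<longleftrightarrow>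
      lex_key w f x \<le> lex_key w f y \<and> sorted (map (lex_key w f) xs @ [(0, 0)])"
    by (simp only: Cons list.map append_Cons sorted2)
  moreover have "lex_key w f x \<le> lex_key w f y \<longleftrightarrow> d \<le> f x \<and> f y \<le> f x - d"
    by (auto simp: lex_key_le_iff d_def Cons)
  moreover have "f y \<le> f x - d \<longleftrightarrow> (\<forall>z \<in> set xs. f z \<le> f x - d)"
    if "sorted (map (lex_key w f) xs @ [(0, 0)])"
    using that by (auto simp: Cons lex_key_le_iff)
  ultimately show ?thesis
    by blast
qed

lemma compatible_maps_Cons:
  fixes w :: "'a \<Rightarrow> 'b::{linorder,zero}" and x :: 'a and xs :: "'a list"
  assumes "x \<notin> set xs"
  defines "d \<equiv> of_bool (hd (map w xs @ [0]) < w x) :: nat"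
  shows "compatible_maps w (x # xs) t =
    (\<lambda>(v, f). f(x := v)) ` (SIGMA v:{d..t}. compatible_maps w xs (v - d))"
proof -
  let ?sorted = "\<lambda>ys f. sorted (map (lex_key w f) ys @ [(0, 0)])"
  have sorted_upd_iff: "?sorted (x # xs) (f(x := v)) \<longleftrightarrow>
      d \<le> v \<and> (\<forall>y \<in> set xs. f y \<le> v - d) \<and> ?sorted xs f" for f v
  proof -
    have "map (lex_key w (f(x := v))) xs = map (lex_key w f) xs"
      using assms(1) by (auto simp: lex_key_def)
    moreover have "(\<forall>y \<in> set xs. (f(x := v)) y \<le> v - d) \<longleftrightarrow> (\<forall>y \<in> set xs. f y \<le> v - d)"
      using assms(1) by auto
    ultimately show ?thesis
      using sorted_lex_keys_Cons_iff[of w "f(x := v)" x xs] by (simp only: d_def fun_upd_same)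
  qed
  have "compatible_maps w (x # xs) t = (\<lambda>(v, f). f(x := v)) `
      {p \<in> {..t} \<times> (set xs \<rightarrow>\<^sub>E {..t}). ?sorted (x # xs) ((\<lambda>(v, f). f(x := v)) p)}"
    unfolding compatible_maps_def list.set(2) PiE_insert_eq Compr_image_eq ..
  also have "{p \<in> {..t} \<times> (set xs \<rightarrow>\<^sub>E {..t}). ?sorted (x # xs) ((\<lambda>(v, f). f(x := v)) p)} =
      (SIGMA v:{d..t}. compatible_maps w xs (v - d))"
    unfolding split_def sorted_upd_iff
    by (auto simp: compatible_maps_def PiE_iff extensional_def
        intro: order.trans[OF _ order.trans[OF diff_le_self]])
  finally show ?thesis .
qed

lemma card_compatible_maps_Cons:
  fixes w :: "'a \<Rightarrow> 'b::{linorder,zero}" and x :: 'a and xs :: "'a list"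
  assumes "x \<notin> set xs"
  defines "d \<equiv> of_bool (hd (map w xs @ [0]) < w x) :: nat"
  shows "card (compatible_maps w (x # xs) t) = (\<Sum>v = d..t. card (compatible_maps w xs (v - d)))"
proof -
  have "inj_on (\<lambda>(v, f). f(x := v)) (SIGMA v:{d..t}. compatible_maps w xs (v - d))"
    by (rule inj_on_subset[OF inj_combinator[OF assms(1), of "\<lambda>_. UNIV"]])
      (auto simp: compatible_maps_def PiE_iff extensional_def)
  then show ?thesis
    using assms(1)
    by (simp add: compatible_maps_Cons card_image finite_compatible_maps flip: d_def)
qed

lemma one_minus_fps_X_mult_shifted_partial_sums:
  fixes a :: "nat \<Rightarrow> 'a::ring_1"
  shows "(1 - fps_X) * Abs_fps (\<lambda>t. \<Sum>v = d..t. a (v - d)) = fps_X ^ d * Abs_fps a"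
proof -
  have "(\<Sum>v = d..t. a (v - d)) = (\<Sum>v = 0..t. fps_nth (fps_X ^ d * Abs_fps a) v)" for t
    by (rule sum.mono_neutral_cong_left) (auto simp: fps_X_power_mult_nth)
  then show ?thesis
    by (simp flip: fps_divide_fps_X_minus1_sum_lemma)
qed

lemma one_minus_fps_X_power_mult_fps_compatible_maps:
  assumes "distinct xs"
  shows "(1 - fps_X) ^ (length xs + 1) * Abs_fps (\<lambda>t. of_nat (card (compatible_maps w xs t))) =
    (fps_X ^ des_B (map w xs) :: 'a::comm_ring_1 fps)"
  using assms
proof (induction xs)
  case Nil
  show ?case
    by (rule fps_ext) (auto simp: compatible_maps_Nil des_B_Nil algebra_simps)
next
  case (Cons x xs)
  define d where "d = (of_bool (hd (map w xs @ [0]) < w x) :: nat)"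
  let ?A = "\<lambda>xs. Abs_fps (\<lambda>t. of_nat (card (compatible_maps w xs t))) :: 'a fps"
  have "of_nat (card (compatible_maps w (x # xs) t)) =
      (\<Sum>v = d..t. of_nat (card (compatible_maps w xs (v - d))) :: 'a)" for t
    using Cons.prems by (simp add: card_compatible_maps_Cons d_def)
  then have mult_Cons: "(1 - fps_X) * ?A (x # xs) = fps_X ^ d * ?A xs"
    using one_minus_fps_X_mult_shifted_partial_sums[where d = d
        and a = "\<lambda>v. of_nat (card (compatible_maps w xs v))"]
    by (simp only:)
  have "(1 - fps_X) ^ (length (x # xs) + 1) * ?A (x # xs) =
      (1 - fps_X) ^ (length xs + 1) * ((1 - fps_X) * ?A (x # xs))"
    by (simp add: ac_simps)
  also have "\<dots> = fps_X ^ d * ((1 - fps_X) ^ (length xs + 1) * ?A xs)"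
    unfolding mult_Cons by (rule mult.left_commute)
  also have "\<dots> = fps_X ^ des_B (map w (x # xs))"
    using Cons by (simp add: des_B_Cons d_def power_add)
  finally show ?case .
qed

subsection \<open>Partitions and linear extensions\<close>

lemma (in linorder) sorted_key_list_of_set_eq_iff:
  fixes key :: "'b \<Rightarrow> 'a"
  assumes "inj_on key A" and "finite A"
  shows "sorted_key_list_of_set key A = xs \<longleftrightarrow> distinct xs \<and> set xs = A \<and> sorted (map key xs)"
proof -
  interpret folding_insort_key "(\<le>)" "(<)" A key
    by unfold_locales (fact assms(1))
  show ?thesis
    using assms sorted_key_list_of_set_unique[of A xs]
    by (auto simp: strict_sorted_iff distinct_map distinct_card)
qed

lemma nth_relation_imp_less_iff_key_less:
  fixes key :: "'a \<Rightarrow> 'b::linorder"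
  assumes "distinct xs" and "sorted (map key xs)" and "inj_on key (set xs)"
  shows "(\<forall>j < length xs. \<forall>k < length xs. R (xs ! j) (xs ! k) \<longrightarrow> j < k) \<longleftrightarrow>
    (\<forall>x \<in> set xs. \<forall>y \<in> set xs. R x y \<longrightarrow> key x < key y)"
proof -
  have "sorted_wrt (<) (map key xs)"
    using assms by (simp add: strict_sorted_iff distinct_map)
  then have "key (xs ! j) < key (xs ! k) \<longleftrightarrow> j < k" if "j < length xs" "k < length xs" for j k
    using that sorted_wrt_nth_less[of "(<)" "map key xs"]
    by (cases j k rule: linorder_cases) fastforce+
  then show ?thesis
    unfolding all_set_conv_all_nth by blast
qed

lemma sorted_key_list_in_linear_extensions_iff:
  fixes key :: "vertex \<Rightarrow> 'b::linorder"
  assumes "inj_on key (vertices F)"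
  shows "sorted_key_list_of_set key (vertices F) \<in> linear_extensions F \<longleftrightarrow>
    (\<forall>x y. forest_less F x y \<longrightarrow> key x \<le> key y)"
proof -
  define xs where "xs = sorted_key_list_of_set key (vertices F)"
  have xs: "distinct xs" "set xs = vertices F" "sorted (map key xs)"
    using sorted_key_list_of_set_eq_iff[OF assms finite_vertices, of xs] by (simp_all add: xs_def)
  have "xs \<in> linear_extensions F \<longleftrightarrow>
      (\<forall>j < length xs. \<forall>k < length xs. forest_less F (xs ! j) (xs ! k) \<longrightarrow> j < k)"
    using xs by (simp add: linear_extensions_def)
  also have "\<dots> \<longleftrightarrow> (\<forall>x \<in> set xs. \<forall>y \<in> set xs. forest_less F x y \<longrightarrow> key x < key y)"
    using xs assms by (intro nth_relation_imp_less_iff_key_less) simp_all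
  also have "\<dots> \<longleftrightarrow> (\<forall>x y. forest_less F x y \<longrightarrow> key x < key y)"
    using xs(2) by (auto simp: forest_less_def)
  also have "\<dots> \<longleftrightarrow> (\<forall>x y. forest_less F x y \<longrightarrow> key x \<le> key y)"
    using assms by (auto simp: forest_less_def inj_on_def less_le)
  finally show ?thesis
    by (simp add: xs_def)
qed

lemma ex_root_above:
  assumes "x \<in> vertices F"
  shows "\<exists>r \<in> roots F. forest_le F x r"
proof -
  from assms obtain i p where x: "x = i # p" and i: "i < length F"
    unfolding vertices_def by (auto elim: is_vertex.cases)
  then have "forest_le F x [i]"
    using assms by (auto simp: forest_le_def forest_less_def vertices_def strict_prefix_def
        intro: is_vertex.root)
  then show ?thesis
    using i by (auto simp: roots_def)
qed

lemma type_B_partitions_iff_lex_key: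
  "f \<in> type_B_partitions F w \<longleftrightarrow> f \<in> vertices F \<rightarrow>\<^sub>E UNIV \<and>
    (\<forall>x y. forest_less F x y \<longrightarrow> lex_key w f x \<le> lex_key w f y) \<and>
    (\<forall>x \<in> vertices F. lex_key w f x \<le> (0, 0))"
proof -
  have "(\<forall>x y. forest_le F y x \<longrightarrow> f x \<le> f y) \<longleftrightarrow> (\<forall>x y. forest_less F y x \<longrightarrow> f x \<le> f y)"
    by (auto simp: forest_le_def forest_less_def)
  then have "f \<in> type_B_partitions F w \<longleftrightarrow> f \<in> vertices F \<rightarrow>\<^sub>E UNIV \<and>
      (\<forall>x y. forest_less F x y \<longrightarrow> lex_key w f x \<le> lex_key w f y) \<and>
      (\<forall>x \<in> roots F. lex_key w f x \<le> (0, 0))"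
    by (auto simp: type_B_partitions_def lex_key_le_iff lex_key_le_zero_iff)
  moreover have "roots F \<subseteq> vertices F"
    by (auto simp: roots_eq_maximal)
  moreover have "lex_key w f x \<le> (0, 0)"
    if "\<forall>x y. forest_less F x y \<longrightarrow> lex_key w f x \<le> lex_key w f y"
      and "\<forall>r \<in> roots F. lex_key w f r \<le> (0, 0)" and "x \<in> vertices F" for x
    using ex_root_above[OF that(3)] that(1,2) by (auto simp: forest_le_def intro: order.trans)
  ultimately show ?thesis
    by blast
qed

definition bounded_partitions ::
  "plane_forest \<Rightarrow> (vertex \<Rightarrow> int) \<Rightarrow> nat \<Rightarrow> (vertex \<Rightarrow> nat) set" where
  "bounded_partitions F w t = {f \<in> type_B_partitions F w. \<forall>x \<in> vertices F. f x \<le> t}"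

definition sorted_vertices ::
  "plane_forest \<Rightarrow> (vertex \<Rightarrow> int) \<Rightarrow> (vertex \<Rightarrow> nat) \<Rightarrow> vertex list" where
  "sorted_vertices F w f = sorted_key_list_of_set (lex_key w f) (vertices F)"

lemma bounded_partitions_eq:
  assumes "inj_on w (vertices F)"
  shows "bounded_partitions F w t = {f \<in> vertices F \<rightarrow>\<^sub>E {..t}.
    sorted_vertices F w f \<in> linear_extensions F \<and>
    (\<forall>x \<in> vertices F. lex_key w f x \<le> (0, 0))}"
  using sorted_key_list_in_linear_extensions_iff[OF inj_on_lex_key[OF assms]]
  by (auto simp: bounded_partitions_def sorted_vertices_def type_B_partitions_iff_lex_key PiE_iff)

lemma compatible_maps_eq_fibre:
  assumes "inj_on w (vertices F)" and "xs \<in> linear_extensions F"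
  shows "compatible_maps w xs t = {f \<in> bounded_partitions F w t. sorted_vertices F w f = xs}"
proof -
  have xs: "distinct xs" "set xs = vertices F"
    using assms(2) by (simp_all add: linear_extensions_def)
  have "sorted_vertices F w f = xs \<longleftrightarrow> sorted (map (lex_key w f) xs)" for f
    using xs sorted_key_list_of_set_eq_iff[OF inj_on_lex_key[OF assms(1)] finite_vertices]
    by (simp add: sorted_vertices_def)
  then have "compatible_maps w xs t = {f \<in> vertices F \<rightarrow>\<^sub>E {..t}.
      sorted_vertices F w f = xs \<and> (\<forall>x \<in> vertices F. lex_key w f x \<le> (0, 0))}"
    by (auto simp: compatible_maps_def sorted_append xs(2))
  then show ?thesis
    using assms(2) by (auto simp: bounded_partitions_eq[OF assms(1)])
qed

lemma finite_linear_extensions: "finite (linear_extensions F)"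
  by (rule finite_subset[OF _ finite_subset_distinct[OF finite_vertices[of F]]])
    (auto simp: linear_extensions_def)

lemma Omega_eq_sum_compatible_maps:
  assumes "inj_on w (vertices F)"
  shows "Omega F w t = (\<Sum>xs \<in> linear_extensions F. card (compatible_maps w xs t))"
proof -
  have "finite (bounded_partitions F w t)"
    unfolding bounded_partitions_eq[OF assms]
    by (rule finite_subset[of _ "vertices F \<rightarrow>\<^sub>E {..t}"]) (auto intro: finite_PiE finite_vertices)
  moreover have "sorted_vertices F w ` bounded_partitions F w t \<subseteq> linear_extensions F"
    by (auto simp: bounded_partitions_eq[OF assms])
  ultimately have "card (bounded_partitions F w t) = (\<Sum>xs \<in> linear_extensions F.
      card {f \<in> bounded_partitions F w t. sorted_vertices F w f = xs})"
    using sum.group[of "bounded_partitions F w t" "linear_extensions F" "sorted_vertices F w"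
        "\<lambda>_. 1 :: nat"]
    by (simp add: finite_linear_extensions)
  then show ?thesis
    by (simp add: Omega_def bounded_partitions_def[symmetric] compatible_maps_eq_fibre[OF assms])
qed

lemma one_minus_fps_X_power_mult_fps_Omega:
  assumes "inj_on w (vertices F)"
  shows "(1 - fps_X) ^ (card (vertices F) + 1) * Abs_fps (\<lambda>t. of_nat (Omega F w t)) =
    (\<Sum>xs \<in> linear_extensions F. fps_X ^ des_B (map w xs) :: 'a::comm_ring_1 fps)"
proof -
  let ?A = "\<lambda>xs. Abs_fps (\<lambda>t. of_nat (card (compatible_maps w xs t))) :: 'a fps"
  have "Abs_fps (\<lambda>t. of_nat (Omega F w t)) = (\<Sum>xs \<in> linear_extensions F. ?A xs)"
    by (rule fps_ext) (simp add: fps_sum_nth Omega_eq_sum_compatible_maps[OF assms])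
  moreover have "(1 - fps_X) ^ (card (vertices F) + 1) * ?A xs = fps_X ^ des_B (map w xs)"
    if "xs \<in> linear_extensions F" for xs
  proof -
    have "distinct xs" and "length xs = card (vertices F)"
      using that by (auto simp: linear_extensions_def distinct_card[symmetric])
    then show ?thesis
      by (metis one_minus_fps_X_power_mult_fps_compatible_maps)
  qed
  ultimately show ?thesis
    by (simp only: sum_distrib_left cong: sum.cong)
qed

lemma sum_linear_extension_words:
  assumes "inj_on w (vertices F)"
  shows "(\<Sum>\<sigma> \<in> linear_extension_words F w. g \<sigma>) = (\<Sum>xs \<in> linear_extensions F. g (map w xs))"
proof -
  have "inj_on (map w) (linear_extensions F)"
    by (rule inj_on_mapI[OF inj_on_subset[OF assms]]) (auto simp: linear_extensions_def)
  then show ?thesis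
    by (simp add: linear_extension_words_def sum.reindex)
qed

lemma signed_labeling_imp_inj_on:
  assumes "signed_labeling F n w"
  shows "inj_on w (vertices F)"
  using assms inj_on_imageI2[of abs w]
  by (simp add: signed_labeling_def bij_betw_def comp_def)

theorem theorem2p4:
  fixes F :: plane_forest and n :: nat and w :: "vertex \<Rightarrow> int"
  assumes "card (vertices F) = n"
    and "signed_labeling F n w"
  shows "(\<Sum>\<sigma> \<in> linear_extension_words F w. fps_X ^ des_B \<sigma>) / (1 - fps_X) ^ (n + 1) =
         (Abs_fps (\<lambda>t. of_nat (Omega F w t)) :: rat fps)"
proof -
  have inj: "inj_on w (vertices F)"
    using assms(2) by (rule signed_labeling_imp_inj_on)
  have "(\<Sum>\<sigma> \<in> linear_extension_words F w. fps_X ^ des_B \<sigma>) =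
      (\<Sum>xs \<in> linear_extensions F. fps_X ^ des_B (map w xs) :: rat fps)"
    by (rule sum_linear_extension_words[OF inj])
  also have "\<dots> = (1 - fps_X) ^ (n + 1) * Abs_fps (\<lambda>t. of_nat (Omega F w t))"
    unfolding assms(1)[symmetric] by (rule one_minus_fps_X_power_mult_fps_Omega[OF inj, symmetric])
  finally show ?thesis
    by simp
qed

end
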